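(* Let $R$ be a $*$-ring (associative with unity), let $n\in\mathbb{N}$ and let $a,b,c\in R$ satisfy $aba=ba^2=a^2c=aca$. Then $ac$ is $pns$-$*$-Drazin invertible if and only if $ba$ is $pns$-$*$-Drazin invertible. In this case, $(ac)^\diamond=a[(ba)^\diamond]^2c$ and $(ba)^\diamond=b[(ac)^\diamond]^2a$.
   Context: $\mathbb{N}$ is the set of positive integers. A $*$-ring is a ring $R$ with a map $*:R\to R$ such that $(x+y)^*=x^*+y^*$, $(xy)^*=y^*x^*$ and $(x^* )^*=x$ for all $x,y\in R$. $J(R)$ is the Jacobson radical and $\sqrt{J(R)}=\{x\in R: x^k\in J(R)\text{ for some }k\ge 1\}$. For $x\in R$: $\mathrm{comm}(x)=\{y\in R: xy=yx\}$ and $\mathrm{comm}^2(x)=\{y\in R: yz=zy\text{ for all }z\in\mathrm{comm}(x)\}$. For fixed $n\in\mathbb{N}$, an element $a$ of a $*$-ring $R$ is $pns$-$*$-Drazin invertible if there exists $x\in R$ with $x\in\mathrm{comm}^2(a)$, $xax=x$, $(ax)^*=ax$ and $a^n-ax\in\sqrt{J(R)}$. Such an $x$ is unique when it exists, is called the $pns$-$*$-Drazin inverse of $a$, and is denoted $a^\diamond$. The same $n$ is used for all elements. *)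

theory Defs
  imports Main
begin

text \<open>The superclass is \<open>ring + monoid_mult\<close> rather than \<open>ring_1\<close>, because \<open>ring_1\<close> requires
  \<open>0 \<noteq> 1\<close> and would exclude the zero ring.\<close>

class star_ring = ring + monoid_mult +
  fixes star :: "'a \<Rightarrow> 'a"  (\<open>_\<^sup>\<star>\<close> [1000] 999)
  assumes star_add: "(x + y)\<^sup>\<star> = x\<^sup>\<star> + y\<^sup>\<star>"
    and star_mult: "(x * y)\<^sup>\<star> = y\<^sup>\<star> * x\<^sup>\<star>"
    and star_star: "(x\<^sup>\<star>)\<^sup>\<star> = x"

definition left_ideal :: "'a::ring set \<Rightarrow> bool" where
  "left_ideal I \<longleftrightarrow>
     0 \<in> I \<and> (\<forall>x\<in>I. \<forall>y\<in>I. x - y \<in> I) \<and> (\<forall>r. \<forall>x\<in>I. r * x \<in> I)"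

definition maximal_left_ideal :: "'a::ring set \<Rightarrow> bool" where
  "maximal_left_ideal M \<longleftrightarrow>
     left_ideal M \<and> M \<noteq> UNIV \<and> (\<forall>I. left_ideal I \<and> M \<subseteq> I \<longrightarrow> I = M \<or> I = UNIV)"

text \<open>In a unital ring this is the usual Jacobson radical; in the zero ring the intersection is
  empty and yields the whole ring.\<close>

definition jacobson_radical :: "'a::{ring,monoid_mult} set" where
  "jacobson_radical = \<Inter> {M. maximal_left_ideal M}"

definition sqrt_jacobson_radical :: "'a::{ring,monoid_mult} set" where
  "sqrt_jacobson_radical = {x. \<exists>k\<ge>1. x ^ k \<in> jacobson_radical}"

definition commutant :: "'a::times \<Rightarrow> 'a set" where
  "commutant x = {y. x * y = y * x}"

definition double_commutant :: "'a::times \<Rightarrow> 'a set" where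
  "double_commutant x = {y. \<forall>z\<in>commutant x. y * z = z * y}"

definition is_pns_star_drazin_inverse :: "nat \<Rightarrow> 'a::star_ring \<Rightarrow> 'a \<Rightarrow> bool" where
  "is_pns_star_drazin_inverse n a x \<longleftrightarrow>
     x \<in> double_commutant a \<and> x * a * x = x \<and> (a * x)\<^sup>\<star> = a * x \<and>
     a ^ n - a * x \<in> sqrt_jacobson_radical"

definition pns_star_drazin_invertible :: "nat \<Rightarrow> 'a::star_ring \<Rightarrow> bool" where
  "pns_star_drazin_invertible n a \<longleftrightarrow> (\<exists>x. is_pns_star_drazin_inverse n a x)"

text \<open>For \<open>n \<ge> 1\<close> the inverse is unique when it exists; otherwise the value is unspecified.\<close>

definition pns_star_drazin_inverse :: "nat \<Rightarrow> 'a::star_ring \<Rightarrow> 'a" where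
  "pns_star_drazin_inverse n a = (THE x. is_pns_star_drazin_inverse n a x)"

end

theory Submission
  imports Defs
begin

text \<open>
  In fact \<open>ac\<close> and \<open>ba\<close> have the same inverse. Put \<open>u = ba\<close> and \<open>v = ac\<close>; the hypotheses say
  \<open>au = ua = av = va\<close>. If \<open>x\<close> is the inverse of either one, then \<open>x\<close> commutes with \<open>a\<close>, and this
  gives \<open>ux = xu = vx = xv =: p\<close> and \<open>ax^2c = x\<close> or \<open>bx^2a = x\<close> respectively. To see that an
  inverse \<open>x\<close> of \<open>u\<close> lies in the double commutant of \<open>v\<close>, take \<open>z\<close> commuting with \<open>v\<close>: then
  \<open>bvza\<close> commutes with \<open>u\<close>, hence with \<open>x\<close>, and this forces \<open>pz = pzp = zp\<close>, so that
  \<open>xz = zx\<close>. In the other direction one uses \<open>azuc\<close>. The radical condition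
  transfers because \<open>a(u^n - p) = (v^n - p)a\<close>, where \<open>u^n - p \<in> Ra\<close> and
  \<open>v^n - p \<in> aR\<close>. Uniqueness rests on the Jacobson radical containing no
  nonzero idempotent.
\<close>

section \<open>Double commutants of \<open>ba\<close> and \<open>ac\<close>\<close>

lemma mult_left_assoc_cong:
  fixes a b c t :: "'a::semigroup_mult"
  shows "a * b = c \<Longrightarrow> a * (b * t) = c * t"
  by (simp flip: mult.assoc)

lemma double_commutant_transfer_left:
  fixes a b c x :: "'a::monoid_mult"
  assumes r1: "a * b * a = b * a * a" and r2: "b * a * a = a * a * c" and r3: "a * a * c = a * c * a"
    and xcomm: "x \<in> double_commutant (b * a)" and xx: "x * (b * a) * x = x"
  shows "x \<in> double_commutant (a * c)" "a * c * x = b * a * x" "a * x * x * c = x"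
proof -
  \<comment> \<open>Simplification nests products to the right by \<open>mult.assoc\<close>;
    \<open>L[OF e]\<close> then applies an equation \<open>e\<close> for a two-factor product in
    front of an arbitrary tail.\<close>
  note L = mult_left_assoc_cong
  define u v p where "u = b * a" and "v = a * c" and "p = x * u"
  have ba: "b * a = u" and ac: "a * c = v" and p0: "x * u = p"
    by (simp_all add: u_def v_def p_def)
  have r: "a * u = u * a" "v * a = u * a" "a * v = u * a"
    using r1 r2 r3 by (simp_all add: u_def v_def mult.assoc)
  have comm: "x * z = z * x" if "u * z = z * u" for z
    using xcomm that by (simp add: u_def double_commutant_def commutant_def)
  have xa: "x * a = a * x"
    by (rule comm) (simp add: r)
  have ux: "u * x = p"
    unfolding p_def by (rule comm[symmetric]) simp
  have px: "p * x = x"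
    using xx by (simp add: p_def u_def)
  then have xp: "x * p = x"
    by (simp add: p_def mult.assoc ux[unfolded p_def])
  have pp: "p * p = p"
    by (metis p_def px mult.assoc)
  \<comment> \<open>Since \<open>u = ba\<close>, the relations give
    \<open>b(av) = b(ua) = b(au)\<close>.\<close>
  have uv: "u * v = u * u"
    by (metis r(1,3) u_def mult.assoc)
  have "x * v = x * x * (u * v)"
    by (simp add: mult.assoc L[OF p0] L[OF xp])
  also have "\<dots> = p"
    by (simp add: uv mult.assoc L[OF p0] L[OF xp] p0)
  finally have xv: "x * v = p" .
  have inner: "a * (x * (x * c)) = x"
    by (simp add: L[OF xa[symmetric]] mult.assoc ac xv xp)
  then show "a * x * x * c = x"
    by (simp add: mult.assoc)
  \<comment> \<open>The relation \<open>va = ua\<close> replaces \<open>v\<close> by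
    \<open>u\<close> only in front of a factor \<open>a\<close>; \<open>inner\<close> supplies that
    factor by rewriting \<open>x\<close> as \<open>axxc\<close>.\<close>
  have "v * x = v * (a * (x * (x * c)))"
    by (simp add: inner)
  also have "\<dots> = u * (a * (x * (x * c)))"
    by (simp add: L[OF r(2)] mult.assoc)
  finally have vx: "v * x = p"
    by (simp add: inner ux)
  then show "a * c * x = b * a * x"
    by (simp add: ac ba ux)
  have pa: "p * a = a * p"
    by (metis p_def r(1) xa mult.assoc)
  have pv: "p * v = v * p"
    by (metis vx xv mult.assoc)
  show "x \<in> double_commutant (a * c)"
  proof -
    have "x * z = z * x" if z: "v * z = z * v" for z
    proof -
      \<comment> \<open>This element is built so that \<open>u\<close> can travel through it:
        \<open>u(bv) = (bv)v\<close>, then \<open>v\<close> passes \<open>z\<close>, and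
        \<open>va = au\<close> releases it on the right as \<open>u\<close>.\<close>
      define y where "y = b * v * z * a"
      have bvv: "u * (b * v) = b * (v * v)"
      proof -
        have "u * (b * v) = b * (a * u * c)"
          by (simp add: u_def v_def mult.assoc)
        also have "\<dots> = b * (v * a * c)"
          by (simp add: r)
        finally show ?thesis
          by (simp add: mult.assoc ac)
      qed
      have "u * y = u * (b * v) * z * a"
        by (simp add: y_def mult.assoc)
      also have "\<dots> = b * (v * v) * z * a"
        by (simp only: bvv)
      also have "\<dots> = b * v * z * (v * a)"
        by (simp add: mult.assoc L[OF z])
      also have "\<dots> = y * u"
        by (simp add: y_def mult.assoc r)
      finally have xy: "x * y = y * x"
        by (rule comm)
      have "x * y = p * c * z * a"
        by (simp add: y_def v_def L[OF ba] L[OF p0] mult.assoc)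
      moreover have "y * x = b * z * p * a"
        by (simp add: y_def L[OF z] L[OF vx] xa[symmetric] mult.assoc)
      \<comment> \<open>The idempotent \<open>p\<close> stands left of \<open>z\<close> on one side
        and right of \<open>z\<close> on the other. It remains to complete these products to
        \<open>pz\<close> and \<open>zp\<close>.\<close>
      ultimately have key: "p * c * z * a = b * z * p * a"
        using xy by simp
      have pz: "p * z * p = p * z"
      proof -
        \<comment> \<open>Substituting \<open>axpc\<close> for \<open>p\<close> creates the block
          \<open>pcza\<close> inside \<open>pz\<close>; \<open>key\<close> turns it into
          \<open>bzpa\<close>, and \<open>p\<close> then moves to the far right, where it is
          absorbed.\<close>
        have axpc: "a * x * p * c = p"
          by (simp add: mult.assoc L[OF pa[symmetric]] L[OF xp] L[OF xa[symmetric]] ac xv)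
        have "p * z = x * (x * v) * z * v"
          by (simp add: mult.assoc z[symmetric] L[OF xv] L[OF xp])
        also have "\<dots> = x * (a * x * p * c) * z * v"
          by (simp add: axpc xv)
        also have "\<dots> = x * a * x * (p * c * z * a) * c"
          by (simp add: mult.assoc ac)
        also have "\<dots> = x * a * x * b * z * v * p"
          by (simp only: key) (simp add: mult.assoc ac pv)
        finally show ?thesis
          by (simp add: mult.assoc pp)
      qed
      have zp: "p * z * p = z * p"
      proof -
        have vv: "v * v = a * (b * v)"
        proof -
          have "v * v = (v * a) * c"
            by (simp add: mult.assoc ac)
          also have "\<dots> = a * u * c"
            by (simp add: r)
          finally show ?thesis
            by (simp add: u_def v_def mult.assoc)
        qed
        \<comment> \<open>The detour through \<open>vv = a(bv)\<close> creates the block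
          \<open>bzpa\<close> inside \<open>zp\<close>. Read backwards, \<open>key\<close> turns it
          into \<open>pcza\<close>, whose \<open>p\<close> commutes with \<open>a\<close> and
          reaches the far left.\<close>
        have "z * p = z * v * v * x * x"
          by (simp add: mult.assoc L[OF vx] px vx)
        also have "\<dots> = v * v * z * x * x"
          by (simp add: mult.assoc L[OF z])
        also have "\<dots> = a * b * z * v * x * x"
          by (simp add: vv mult.assoc L[OF z])
        also have "\<dots> = a * b * z * (p * v * x) * x"
          by (simp add: mult.assoc L[OF vx] px pp L[OF pp])
        also have "\<dots> = a * (b * z * p * a) * c * x * x"
          by (simp add: v_def mult.assoc)
        also have "\<dots> = p * (a * c * z * a * c * x * x)"
          by (simp only: key[symmetric]) (simp add: mult.assoc L[OF pa])
        finally show ?thesis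
          by (metis pp mult.assoc)
      qed
      have "x * z = x * (p * z)"
        by (simp add: L[OF xp])
      also have "\<dots> = x * z * p"
        using pz zp by (simp add: mult.assoc)
      also have "\<dots> = x * v * z * x"
        by (simp add: vx[symmetric] mult.assoc L[OF z])
      also have "\<dots> = z * p * x"
        using pz zp by (simp add: xv)
      also have "\<dots> = z * x"
        by (simp add: mult.assoc px)
      finally show ?thesis .
    qed
    then show ?thesis
      by (simp add: double_commutant_def commutant_def v_def)
  qed
qed

text \<open>Reversing all products and exchanging \<open>b\<close> with \<open>c\<close> preserves
  the hypotheses and exchanges \<open>ba\<close> with \<open>ac\<close>. The argument is therefore
  the left-right dual of the preceding one, with the roles of \<open>pz\<close> and
  \<open>zp\<close> interchanged.\<close>

lemma double_commutant_transfer_right: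
  fixes a b c x :: "'a::monoid_mult"
  assumes r1: "a * b * a = b * a * a" and r2: "b * a * a = a * a * c" and r3: "a * a * c = a * c * a"
    and xcomm: "x \<in> double_commutant (a * c)" and xx: "x * (a * c) * x = x"
  shows "x \<in> double_commutant (b * a)" "b * a * x = a * c * x" "b * x * x * a = x"
proof -
  note L = mult_left_assoc_cong
  define u v p where "u = b * a" and "v = a * c" and "p = v * x"
  have ba: "b * a = u" and ac: "a * c = v" and vx: "v * x = p"
    by (simp_all add: u_def v_def p_def)
  have r: "a * u = a * v" "v * a = a * v" "u * a = a * v"
    using r1 r2 r3 by (simp_all add: u_def v_def mult.assoc)
  have comm: "x * z = z * x" if "v * z = z * v" for z
    using xcomm that by (simp add: v_def double_commutant_def commutant_def)
  have xa: "x * a = a * x"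
    by (rule comm) (simp add: r)
  have xv: "x * v = p"
    unfolding p_def by (rule comm) simp
  have px: "p * x = x"
    using xx by (simp add: v_def flip: xv)
  have xp: "x * p = x"
    using xx by (simp add: p_def v_def mult.assoc)
  have pp: "p * p = p"
    by (metis p_def xp mult.assoc)
  have uv: "u * v = v * v"
    by (metis r(2,3) v_def mult.assoc)
  have "u * x = u * v * x * x"
    by (simp add: mult.assoc L[OF vx] px)
  also have "\<dots> = p"
    by (simp add: uv mult.assoc L[OF vx] px vx)
  finally have ux: "u * x = p" .
  then show "b * a * x = a * c * x"
    by (simp add: ba ac vx)
  have inner: "b * (x * (x * a)) = x"
    by (simp add: xa L[OF xa] L[OF ba] L[OF ux] px mult.assoc)
  then show "b * x * x * a = x"
    by (simp add: mult.assoc)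
  have "x * u = b * (x * (x * a)) * u"
    by (simp add: inner)
  also have "\<dots> = b * (x * (x * a)) * v"
    by (simp add: mult.assoc r)
  finally have xu: "x * u = p"
    by (simp add: inner xv)
  have pa: "p * a = a * p"
    by (metis p_def r(2) xa mult.assoc)
  have pu: "p * u = u * p"
    by (metis ux xu mult.assoc)
  show "x \<in> double_commutant (b * a)"
  proof -
    have "x * z = z * x" if z: "u * z = z * u" for z
    proof -
      \<comment> \<open>Here \<open>va = au\<close> turns an incoming \<open>v\<close> into
        \<open>u\<close>, which passes \<open>z\<close> and leaves on the right as \<open>v\<close>
        by \<open>u(uc) = (uc)v\<close>.\<close>
      define y where "y = a * z * u * c"
      have ucv: "u * (c * v) = u * (u * c)"
      proof -
        have "u * (c * v) = b * (v * a) * c"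
          by (simp add: u_def v_def mult.assoc)
        also have "\<dots> = b * (a * u) * c"
          by (simp add: r)
        finally show ?thesis
          by (simp add: mult.assoc L[OF ba])
      qed
      have "v * y = a * u * z * u * c"
        by (simp add: y_def L[OF r(1)] L[OF r(2)] mult.assoc)
      also have "\<dots> = a * z * (u * (u * c))"
        by (simp add: mult.assoc L[OF z])
      also have "\<dots> = y * v"
        by (simp add: y_def mult.assoc ucv)
      finally have xy: "x * y = y * x"
        by (rule comm)
      have "x * y = a * p * z * c"
        by (simp add: y_def L[OF xa] L[OF z[symmetric]] L[OF xu] mult.assoc)
      moreover have "y * x = a * z * b * p"
        by (simp add: y_def u_def L[OF ac] vx mult.assoc)
      ultimately have key: "a * p * z * c = a * z * b * p"
        using xy by simp
      have zp: "p * z * p = z * p"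
      proof -
        have bpxa: "b * p * x * a = p"
          by (simp add: mult.assoc L[OF pa] px xa L[OF ba] ux)
        have "z * p = u * z * p * x"
          by (simp add: mult.assoc L[OF z] ux px)
        also have "\<dots> = u * z * (b * p * x * a) * x"
          by (simp only: bpxa)
        also have "\<dots> = b * (a * z * b * p) * x * a * x"
          by (simp add: mult.assoc u_def)
        also have "\<dots> = p * (u * z * c * x * a * x)"
          by (simp only: key[symmetric]) (simp add: mult.assoc L[OF ba] L[OF pu])
        finally show ?thesis
          by (metis pp mult.assoc)
      qed
      have pz: "p * z * p = p * z"
      proof -
        have uu: "u * u = u * c * a"
        proof -
          have "u * u = b * (a * u)"
            by (simp add: mult.assoc L[OF ba])
          also have "\<dots> = b * (v * a)"
            by (simp add: r)
          finally show ?thesis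
            by (simp add: u_def v_def mult.assoc)
        qed
        have "p * z = x * x * u * u * z"
          by (simp add: mult.assoc L[OF xu] L[OF xp])
        also have "\<dots> = x * x * z * (u * u)"
          by (simp add: mult.assoc z L[OF z])
        also have "\<dots> = x * (x * u) * z * c * a"
          by (simp add: uu mult.assoc L[OF z])
        also have "\<dots> = x * (x * u * p) * z * c * a"
          by (simp add: xu pp)
        also have "\<dots> = x * x * b * (a * p * z * c) * a"
          by (simp add: u_def mult.assoc)
        also have "\<dots> = x * x * b * a * z * b * a * p"
          by (simp only: key) (simp add: mult.assoc pa)
        finally show ?thesis
          by (simp add: mult.assoc pp)
      qed
      have "x * z = x * (p * z)"
        by (simp add: L[OF xp])
      also have "\<dots> = x * z * p"
        using pz zp by (simp add: mult.assoc)
      also have "\<dots> = x * u * z * x"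
        by (simp add: ux[symmetric] mult.assoc L[OF z])
      also have "\<dots> = z * p * x"
        using pz zp by (simp add: xu)
      also have "\<dots> = z * x"
        by (simp add: mult.assoc px)
      finally show ?thesis .
    qed
    then show ?thesis
      by (simp add: double_commutant_def commutant_def u_def)
  qed
qed

section \<open>Left ideals and the Jacobson radical\<close>

lemma left_ideal_add:
  assumes "left_ideal I" "x \<in> I" "y \<in> I"
  shows "x + y \<in> I"
proof -
  have "0 - y \<in> I"
    using assms unfolding left_ideal_def by blast
  then have "x - (0 - y) \<in> I"
    using assms unfolding left_ideal_def by blast
  then show ?thesis
    by simp
qed

lemma left_ideal_eq_UNIV:
  fixes I :: "'a::{ring,monoid_mult} set"
  assumes "left_ideal I" "1 \<in> I"
  shows "I = UNIV"
proof -
  have "r * 1 \<in> I" for r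
    using assms unfolding left_ideal_def by blast
  then show ?thesis
    by auto
qed

lemma left_ideal_adjoin:
  fixes M :: "'a::{ring,monoid_mult} set"
  assumes "left_ideal M"
  shows "left_ideal {m + s * t | m s. m \<in> M}"
  unfolding left_ideal_def
proof (intro conjI ballI allI)
  show "0 \<in> {m + s * t | m s. m \<in> M}"
    using assms by (auto simp: left_ideal_def intro!: exI[of _ 0])
next
  fix x y assume "x \<in> {m + s * t | m s. m \<in> M}" "y \<in> {m + s * t | m s. m \<in> M}"
  then obtain m s m' s' where "x = m + s * t" "m \<in> M" "y = m' + s' * t" "m' \<in> M"
    by auto
  moreover from this have "x - y = (m - m') + (s - s') * t"
    by (simp add: algebra_simps)
  moreover have "m - m' \<in> M"
    using assms calculation by (auto simp: left_ideal_def)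
  ultimately show "x - y \<in> {m + s * t | m s. m \<in> M}"
    by blast
next
  fix r x assume "x \<in> {m + s * t | m s. m \<in> M}"
  then obtain m s where "x = m + s * t" "m \<in> M"
    by auto
  moreover from this have "r * x = r * m + (r * s) * t"
    by (simp add: algebra_simps)
  moreover have "r * m \<in> M"
    using assms calculation by (auto simp: left_ideal_def)
  ultimately show "r * x \<in> {m + s * t | m s. m \<in> M}"
    by blast
qed

text \<open>The set is the annihilator of the class of \<open>r\<close> in the simple left module
  \<open>R/M\<close>. That class is nonzero, hence generates the module, so the quotient by its
  annihilator is again simple. This is what makes the intersection of all maximal left ideals closed
  under right multiplication.\<close>

lemma maximal_left_ideal_quotient:
  fixes M :: "'a::{ring,monoid_mult} set"
  assumes M: "maximal_left_ideal M" and r: "r \<notin> M"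
  shows "maximal_left_ideal {x. x * r \<in> M}" (is "maximal_left_ideal ?N")
proof -
  have lM: "left_ideal M"
    using M by (simp add: maximal_left_ideal_def)
  have "left_ideal ?N"
    using lM by (auto simp: left_ideal_def left_diff_distrib mult.assoc)
  moreover have "?N \<noteq> UNIV"
  proof
    assume "?N = UNIV"
    then have "1 * r \<in> M"
      by blast
    then show False
      using r by simp
  qed
  moreover have "I = UNIV" if I: "left_ideal I" "?N \<subseteq> I" "I \<noteq> ?N" for I
  proof -
    obtain i where i: "i \<in> I" "i * r \<notin> M"
      using I by auto
    \<comment> \<open>This left ideal properly contains \<open>M\<close>, so it contains
      \<open>r\<close>. Solving \<open>r = m + s(ir)\<close> for \<open>m\<close> gives
      \<open>(1 - si)r\<close> in \<open>M\<close>, which yields \<open>1\<close> in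
      \<open>I\<close>.\<close>
    let ?K = "{m + s * (i * r) | m s. m \<in> M}"
    have "left_ideal ?K"
      using lM by (rule left_ideal_adjoin)
    moreover have "M \<subseteq> ?K"
      by (force intro: exI[of _ 0])
    moreover have "i * r \<in> ?K"
      using lM by (force simp: left_ideal_def intro: exI[of _ 0] exI[of _ 1])
    ultimately have "?K = UNIV"
      using M i unfolding maximal_left_ideal_def by blast
    then obtain m s where "r = m + s * (i * r)" "m \<in> M"
      by blast
    then have "(1 - s * i) * r \<in> M"
      by (metis add_diff_cancel_right' left_diff_distrib mult.assoc mult_1_left)
    then have "1 - s * i \<in> I"
      using I by blast
    moreover have "s * i \<in> I"
      using I i by (auto simp: left_ideal_def)
    ultimately have "1 - s * i + s * i \<in> I"
      by (rule left_ideal_add[OF I(1)])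
    then show ?thesis
      using I by (simp add: left_ideal_eq_UNIV)
  qed
  ultimately show ?thesis
    unfolding maximal_left_ideal_def by blast
qed

lemma jacobson_radical_mult_left: "j \<in> jacobson_radical \<Longrightarrow> r * j \<in> jacobson_radical"
  by (auto simp: jacobson_radical_def maximal_left_ideal_def left_ideal_def)

lemma jacobson_radical_mult_right:
  assumes "j \<in> jacobson_radical"
  shows "j * r \<in> jacobson_radical"
  unfolding jacobson_radical_def
proof (intro InterI, clarify)
  fix M :: "'a set" assume M: "maximal_left_ideal M"
  show "j * r \<in> M"
  proof (cases "r \<in> M")
    case True
    then show ?thesis
      using M by (auto simp: maximal_left_ideal_def left_ideal_def)
  next
    case False
    then show ?thesis
      using maximal_left_ideal_quotient[OF M] assms by (auto simp: jacobson_radical_def)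
  qed
qed

lemma maximal_left_ideal_exists:
  fixes I :: "'a::{ring,monoid_mult} set"
  assumes I: "left_ideal I" "1 \<notin> I"
  obtains M where "maximal_left_ideal M" "I \<subseteq> M"
proof -
  \<comment> \<open>Properness is expressed by omitting \<open>1\<close>, a condition inherited by
    unions of chains, so that Zorn's lemma applies.\<close>
  let ?A = "{K. left_ideal K \<and> I \<subseteq> K \<and> 1 \<notin> K}"
  have "\<exists>M\<in>?A. \<forall>X\<in>?A. M \<subseteq> X \<longrightarrow> X = M"
  proof (rule subset_Zorn_nonempty)
    show "?A \<noteq> {}"
      using I by blast
  next
    fix C assume C: "C \<noteq> {}" "subset.chain ?A C"
    then have CA: "C \<subseteq> ?A" and lin: "\<And>X Y. X \<in> C \<Longrightarrow> Y \<in> C \<Longrightarrow> X \<subseteq> Y \<or> Y \<subseteq> X"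
      by (auto simp: subset_chain_def)
    have "x - y \<in> \<Union> C" if xy: "x \<in> X" "X \<in> C" "y \<in> Y" "Y \<in> C" for x y X Y
    proof -
      obtain Z where Z: "Z \<in> C" "x \<in> Z" "y \<in> Z"
        using lin[of X Y] xy by blast
      then have "left_ideal Z"
        using CA by blast
      then show ?thesis
        using Z by (auto simp: left_ideal_def)
    qed
    moreover have "r * x \<in> \<Union> C" if "x \<in> X" "X \<in> C" for r x X
    proof -
      have "left_ideal X"
        using CA that by blast
      then show ?thesis
        using that unfolding left_ideal_def by blast
    qed
    moreover have "0 \<in> \<Union> C"
    proof -
      obtain X where "X \<in> C"
        using C(1) by blast
      moreover from this have "left_ideal X"
        using CA by blast
      ultimately show ?thesis
        unfolding left_ideal_def by blast
    qed
    ultimately have "left_ideal (\<Union> C)"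
      unfolding left_ideal_def by blast
    then show "\<Union> C \<in> ?A"
      using C(1) CA by blast
  qed
  then obtain M where M: "M \<in> ?A" "\<forall>X\<in>?A. M \<subseteq> X \<longrightarrow> X = M"
    by blast
  have "maximal_left_ideal M"
    unfolding maximal_left_ideal_def
  proof (intro conjI allI impI)
    fix K assume K: "left_ideal K \<and> M \<subseteq> K"
    show "K = M \<or> K = UNIV"
    proof (cases "1 \<in> K")
      case True
      then show ?thesis
        using K left_ideal_eq_UNIV by blast
    next
      case False
      then show ?thesis
        using K M by blast
    qed
  qed (use M in auto)
  then show thesis
    using M that by blast
qed

text \<open>For nonzero \<open>g\<close> the left annihilator of \<open>g\<close> is proper and
  contains \<open>1 - g\<close>. A maximal left ideal above it also contains the radical element
  \<open>g\<close>, hence \<open>1\<close>.\<close>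

lemma idempotent_in_jacobson_radical:
  fixes g :: "'a::{ring,monoid_mult}"
  assumes g: "g * g = g" "g \<in> jacobson_radical"
  shows "g = 0"
proof (rule ccontr)
  assume "g \<noteq> 0"
  let ?I = "{x. x * g = 0}"
  have "left_ideal ?I"
    by (auto simp: left_ideal_def left_diff_distrib mult.assoc)
  moreover have "1 \<notin> ?I"
    using \<open>g \<noteq> 0\<close> by simp
  ultimately obtain M where M: "maximal_left_ideal M" "?I \<subseteq> M"
    by (rule maximal_left_ideal_exists)
  have "(1 - g) * g = 0"
    by (simp add: left_diff_distrib g)
  then have "1 - g \<in> M"
    using M by blast
  moreover have "g \<in> M"
    using M g by (auto simp: jacobson_radical_def)
  ultimately have "1 - g + g \<in> M"
    using M by (intro left_ideal_add) (auto simp: maximal_left_ideal_def)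
  then show False
    using M left_ideal_eq_UNIV by (auto simp: maximal_left_ideal_def)
qed

section \<open>Intertwined powers and the root of the radical\<close>

lemma power_mult_intertwine:
  fixes a u v :: "'a::monoid_mult"
  assumes "a * u = v * a"
  shows "a * u ^ k = v ^ k * a"
proof (induction k)
  case (Suc k)
  then show ?case
    by (metis assms mult.assoc power_Suc)
qed simp

text \<open>The factorizations give \<open>v^(k+1) = a u^k s\<close> and
  \<open>u^(k+1) = t v^k a\<close>. As the radical is two-sided, membership of a power passes across
  at the cost of one more factor.\<close>

lemma sqrt_jacobson_radical_intertwine:
  fixes a u v s t :: "'a::{ring,monoid_mult}"
  assumes au: "a * u = v * a" and u: "u = t * a" and v: "v = a * s"
  shows "u \<in> sqrt_jacobson_radical \<longleftrightarrow> v \<in> sqrt_jacobson_radical"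
proof
  assume "u \<in> sqrt_jacobson_radical"
  then obtain k where k: "u ^ k \<in> jacobson_radical"
    by (auto simp: sqrt_jacobson_radical_def)
  have "v ^ Suc k = a * u ^ k * s"
    using power_mult_intertwine[OF au, of k] v by (metis mult.assoc power_Suc2)
  then have "v ^ Suc k \<in> jacobson_radical"
    using k by (simp add: jacobson_radical_mult_left jacobson_radical_mult_right del: power_Suc)
  then show "v \<in> sqrt_jacobson_radical"
    unfolding sqrt_jacobson_radical_def by (intro CollectI exI[of _ "Suc k"]) simp
next
  assume "v \<in> sqrt_jacobson_radical"
  then obtain k where k: "v ^ k \<in> jacobson_radical"
    by (auto simp: sqrt_jacobson_radical_def)
  have "u ^ Suc k = t * v ^ k * a"
    using power_mult_intertwine[OF au, of k] u by (metis mult.assoc power_Suc)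
  then have "u ^ Suc k \<in> jacobson_radical"
    using k by (simp add: jacobson_radical_mult_left jacobson_radical_mult_right del: power_Suc)
  then show "u \<in> sqrt_jacobson_radical"
    unfolding sqrt_jacobson_radical_def by (intro CollectI exI[of _ "Suc k"]) simp
qed

lemma sqrt_jacobson_radical_transfer:
  fixes a b c x :: "'a::{ring,monoid_mult}"
  assumes n: "n \<ge> 1" and aba: "a * b * a = a * c * a" and xa: "x * a = a * x"
    and acx: "a * c * x = b * a * x"
    and pa: "b * a * x * a = a * (b * a * x)"
  shows "(b * a) ^ n - b * a * x \<in> sqrt_jacobson_radical \<longleftrightarrow>
    (a * c) ^ n - a * c * x \<in> sqrt_jacobson_radical"
proof -
  \<comment> \<open>A positive exponent lets one factor be split off: \<open>(ba)^n\<close> ends in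
    \<open>a\<close> and \<open>(ac)^n\<close> begins with \<open>a\<close>.\<close>
  obtain m where m: "n = Suc m"
    using n by (cases n) auto
  show ?thesis
  proof (rule sqrt_jacobson_radical_intertwine)
    have "a * (b * a) ^ n = (a * c) ^ n * a"
      by (rule power_mult_intertwine) (metis aba mult.assoc)
    then show "a * ((b * a) ^ n - b * a * x) = ((a * c) ^ n - a * c * x) * a"
      by (simp add: acx pa left_diff_distrib right_diff_distrib)
    have "b * a * x = b * x * a"
      by (simp add: xa mult.assoc)
    then show "(b * a) ^ n - b * a * x = ((b * a) ^ m * b - b * x) * a"
      unfolding m power_Suc2 by (simp add: left_diff_distrib mult.assoc)
    show "(a * c) ^ n - a * c * x = a * (c * (a * c) ^ m - c * x)"
      unfolding m power_Suc by (simp add: right_diff_distrib mult.assoc)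
  qed
qed

section \<open>Uniqueness of the inverse\<close>

lemma pns_star_drazin_inverse_projection_absorb:
  fixes u :: "'a::star_ring"
  assumes x: "is_pns_star_drazin_inverse n u x" and y: "is_pns_star_drazin_inverse n u y"
  shows "u * x * (u * y) = u * x"
proof -
  define q where "q = u * y"
  have comm: "x * z = z * x" "y * z = z * y" if "u * z = z * u" for z
    using x y that
    by (auto simp: is_pns_star_drazin_inverse_def double_commutant_def commutant_def)
  have ux: "u * x = x * u" and uy: "u * y = y * u"
    using comm[of u] by simp_all
  have uq: "u * q = q * u"
    unfolding q_def by (metis uy mult.assoc)
  have xq: "x * q = q * x"
    by (rule comm) (rule uq)
  have qq: "q * q = q"
    using y unfolding q_def is_pns_star_drazin_inverse_def by (metis mult.assoc)
  have pp: "u * x * (u * x) = u * x"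
    using x unfolding is_pns_star_drazin_inverse_def by (metis mult.assoc)
  obtain k where k: "(u ^ n - q) ^ k \<in> jacobson_radical"
    using y unfolding q_def is_pns_star_drazin_inverse_def sqrt_jacobson_radical_def by auto
  \<comment> \<open>The idempotent \<open>1 - q\<close> annihilates \<open>q\<close> and commutes
    with \<open>u^n\<close>, so each subtracted \<open>q\<close> vanishes from the power.\<close>
  have power_one_minus: "(1 - q) * (u ^ n - q) ^ i = (1 - q) * (u ^ n) ^ i" for i
  proof (induction i)
    case (Suc i)
    have "u ^ n * q = q * u ^ n"
      using power_mult_intertwine[of q u u n] uq by simp
    then have step: "(1 - q) * (u ^ n - q) = u ^ n * (1 - q)"
      by (simp add: algebra_simps qq)
    have "(1 - q) * (u ^ n - q) ^ Suc i = u ^ n * ((1 - q) * (u ^ n - q) ^ i)"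
      by (simp add: step mult.assoc[symmetric])
    also have "\<dots> = u ^ n * (1 - q) * (u ^ n) ^ i"
      by (simp add: Suc mult.assoc)
    also have "\<dots> = (1 - q) * (u ^ n) ^ Suc i"
      using \<open>u ^ n * q = q * u ^ n\<close> by (simp add: algebra_simps)
    finally show ?case .
  qed simp
  \<comment> \<open>On the corner cut out by the idempotent \<open>ux\<close>, the element
    \<open>x\<close> inverts \<open>u\<close>; powers of \<open>u\<close> can thus be inserted and
    cancelled.\<close>
  have ux_power: "u ^ i * x ^ i * (u * x) = u * x" for i
  proof (induction i)
    case (Suc i)
    have "u ^ Suc i * x ^ Suc i * (u * x) = u ^ i * (u * x ^ i) * x * (u * x)"
      by (simp add: power_Suc2 mult.assoc del: power_Suc)
    also have "u * x ^ i = x ^ i * u"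
      by (rule power_mult_intertwine) (rule ux)
    also have "u ^ i * (x ^ i * u) * x * (u * x) = u ^ i * x ^ i * (u * x * (u * x))"
      by (simp add: mult.assoc)
    finally show ?case
      by (simp add: pp Suc)
  qed simp
  \<comment> \<open>The defect of absorption. It is idempotent because \<open>q\<close> and
    \<open>ux\<close> commute, and it lies in the radical because inserting
    \<open>u^(nk) x^(nk)\<close> exposes the factor \<open>(u^n - q)^k\<close>. Hence it is
    zero.\<close>
  define g where "g = (1 - q) * (u * x)"
  have "g = (1 - q) * (u ^ n) ^ k * (x ^ (n * k) * (u * x))"
    using ux_power[of "n * k"] by (simp add: g_def power_mult mult.assoc)
  also have "\<dots> = (1 - q) * (u ^ n - q) ^ k * (x ^ (n * k) * (u * x))"
    by (simp add: power_one_minus)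
  also have "\<dots> \<in> jacobson_radical"
    using k by (intro jacobson_radical_mult_left jacobson_radical_mult_right)
  finally have gJ: "g \<in> jacobson_radical" .
  have pq: "u * x * q = q * (u * x)"
    by (metis uq xq mult.assoc)
  have "g * g = (1 - q) * (u * x * (1 - q)) * (u * x)"
    by (simp add: g_def mult.assoc)
  also have "u * x * (1 - q) = (1 - q) * (u * x)"
    using pq by (simp add: left_diff_distrib right_diff_distrib)
  also have "(1 - q) * ((1 - q) * (u * x)) * (u * x) = (1 - q) * (1 - q) * (u * x * (u * x))"
    by (simp add: mult.assoc)
  also have "\<dots> = g"
    by (simp add: g_def pp) (simp add: left_diff_distrib right_diff_distrib qq)
  finally have "g = 0"
    using gJ by (rule idempotent_in_jacobson_radical)
  then show ?thesis
    using pq by (simp add: g_def q_def left_diff_distrib)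
qed

text \<open>Absorption in both directions gives \<open>x = xuy = yux = y\<close>.\<close>

lemma is_pns_star_drazin_inverse_unique:
  fixes u :: "'a::star_ring"
  assumes x: "is_pns_star_drazin_inverse n u x" and y: "is_pns_star_drazin_inverse n u y"
  shows "x = y"
proof -
  have ux: "u * x = x * u" and uy: "u * y = y * u" and xux: "x * u * x = x" and yuy: "y * u * y = y"
    using x y by (auto simp: is_pns_star_drazin_inverse_def double_commutant_def commutant_def)
  have xy: "x * y = y * x"
  proof -
    have "\<forall>z. u * z = z * u \<longrightarrow> x * z = z * x"
      using x by (simp add: is_pns_star_drazin_inverse_def double_commutant_def commutant_def)
    then show ?thesis
      using uy by blast
  qed
  have "x = x * u * y"
    using pns_star_drazin_inverse_projection_absorb[OF x y] xux ux by (metis mult.assoc)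
  also have "\<dots> = y * u * x"
    using ux uy xy by (metis mult.assoc)
  also have "\<dots> = y"
    using pns_star_drazin_inverse_projection_absorb[OF y x] yuy uy by (metis mult.assoc)
  finally show ?thesis .
qed

lemma pns_star_drazin_inverse_eq:
  "is_pns_star_drazin_inverse n u x \<Longrightarrow> pns_star_drazin_inverse n u = x"
  unfolding pns_star_drazin_inverse_def
  by (rule the_equality) (auto intro: is_pns_star_drazin_inverse_unique)

section \<open>Transfer of the inverse and its formulas\<close>

lemma is_pns_star_drazin_inverse_ba_imp_ac:
  fixes a b c x :: "'a::star_ring"
  assumes n: "n \<ge> 1"
    and r: "a * b * a = b * a * a" "b * a * a = a * a * c" "a * a * c = a * c * a"
    and x: "is_pns_star_drazin_inverse n (b * a) x"
  shows "is_pns_star_drazin_inverse n (a * c) x" "a * x * x * c = x"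
proof -
  have xD: "x \<in> double_commutant (b * a)" "x * (b * a) * x = x"
    using x by (auto simp: is_pns_star_drazin_inverse_def)
  note tr = double_commutant_transfer_left[OF r xD]
  have xa: "x * a = a * x"
    using xD(1) r(1) by (simp add: double_commutant_def commutant_def mult.assoc)
  have pa: "b * a * x * a = a * (b * a * x)"
    using xa r(1) by (metis mult.assoc)
  have xba: "x * (b * a) = b * a * x"
    using xD(1) by (simp add: double_commutant_def commutant_def)
  have xac: "x * (a * c) = a * c * x"
    using tr(1) by (simp add: double_commutant_def commutant_def)
  have "x * (a * c) * x = x"
    using xD(2) xba xac tr(2) by simp
  moreover have "(a * c) ^ n - a * c * x \<in> sqrt_jacobson_radical"
    using sqrt_jacobson_radical_transfer[OF n _ xa tr(2) pa] r x
    by (simp add: is_pns_star_drazin_inverse_def)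
  \<comment> \<open>Self-adjointness carries over at once, because \<open>acx\<close> and
    \<open>bax\<close> are the same element.\<close>
  ultimately show "is_pns_star_drazin_inverse n (a * c) x"
    using tr x by (simp add: is_pns_star_drazin_inverse_def)
  show "a * x * x * c = x"
    by (rule tr)
qed

lemma is_pns_star_drazin_inverse_ac_imp_ba:
  fixes a b c x :: "'a::star_ring"
  assumes n: "n \<ge> 1"
    and r: "a * b * a = b * a * a" "b * a * a = a * a * c" "a * a * c = a * c * a"
    and x: "is_pns_star_drazin_inverse n (a * c) x"
  shows "is_pns_star_drazin_inverse n (b * a) x" "b * x * x * a = x"
proof -
  have xD: "x \<in> double_commutant (a * c)" "x * (a * c) * x = x"
    using x by (auto simp: is_pns_star_drazin_inverse_def)
  note tr = double_commutant_transfer_right[OF r xD]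
  have xa: "x * a = a * x"
    using xD(1) r(3) by (simp add: double_commutant_def commutant_def mult.assoc)
  have pa: "b * a * x * a = a * (b * a * x)"
    using xa r(1) by (metis mult.assoc)
  have xba: "x * (b * a) = b * a * x"
    using tr(1) by (simp add: double_commutant_def commutant_def)
  have xac: "x * (a * c) = a * c * x"
    using xD(1) by (simp add: double_commutant_def commutant_def)
  have "x * (b * a) * x = x"
    using xD(2) xba xac tr(2) by simp
  moreover have "(b * a) ^ n - b * a * x \<in> sqrt_jacobson_radical"
    using sqrt_jacobson_radical_transfer[OF n _ xa tr(2)[symmetric] pa] r x
    by (simp add: is_pns_star_drazin_inverse_def)
  ultimately show "is_pns_star_drazin_inverse n (b * a) x"
    using tr x by (simp add: is_pns_star_drazin_inverse_def)
  show "b * x * x * a = x"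
    by (rule tr)
qed

theorem theorem3p7:
  fixes a b c :: "'a::star_ring" and n :: nat
  assumes "n \<ge> 1"
    and "a * b * a = b * a ^ 2"
    and "b * a ^ 2 = a ^ 2 * c"
    and "a ^ 2 * c = a * c * a"
  shows "(pns_star_drazin_invertible n (a * c) \<longleftrightarrow> pns_star_drazin_invertible n (b * a)) \<and>
    (pns_star_drazin_invertible n (b * a) \<longrightarrow>
       pns_star_drazin_inverse n (a * c) = a * (pns_star_drazin_inverse n (b * a)) ^ 2 * c \<and>
       pns_star_drazin_inverse n (b * a) = b * (pns_star_drazin_inverse n (a * c)) ^ 2 * a)"
proof -
  have r: "a * b * a = b * a * a" "b * a * a = a * a * c" "a * a * c = a * c * a"
    using assms(2-4) by (simp_all add: power2_eq_square mult.assoc)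
  note ac = is_pns_star_drazin_inverse_ba_imp_ac[OF assms(1) r]
    and ba = is_pns_star_drazin_inverse_ac_imp_ba[OF assms(1) r]
  have "pns_star_drazin_invertible n (a * c) \<longleftrightarrow> pns_star_drazin_invertible n (b * a)"
    unfolding pns_star_drazin_invertible_def using ac(1) ba(1) by blast
  moreover have "pns_star_drazin_inverse n (a * c) = a * (pns_star_drazin_inverse n (b * a)) ^ 2 * c \<and>
       pns_star_drazin_inverse n (b * a) = b * (pns_star_drazin_inverse n (a * c)) ^ 2 * a"
    if inv: "pns_star_drazin_invertible n (b * a)"
  proof -
    obtain x where x: "is_pns_star_drazin_inverse n (b * a) x"
      using inv unfolding pns_star_drazin_invertible_def by blast
    have "pns_star_drazin_inverse n (b * a) = x" "pns_star_drazin_inverse n (a * c) = x"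
      using x ac(1) by (auto intro: pns_star_drazin_inverse_eq)
    \<comment> \<open>The first equation comes from \<open>x\<close> as inverse of
      \<open>ba\<close>, the second from the same \<open>x\<close> as inverse of
      \<open>ac\<close>.\<close>
    moreover have "a * x ^ 2 * c = x" "b * x ^ 2 * a = x"
      using ac(2)[OF x] ba(2)[OF ac(1)[OF x]] by (simp_all add: power2_eq_square mult.assoc)
    ultimately show ?thesis
      by simp
  qed
  ultimately show ?thesis
    by blast
qed

end
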